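(* Let $Z_n=(\mathrm{UD})^n$ denote the zig-zag Dyck path UDUD$\cdots$UD of order $n$. For each permutation $\sigma$ of order $n$, $\operatorname{art}(\operatorname{DTR}(Z_n,\sigma))=\mathrm{mad}(\sigma)$.
   Context: For a permutation $\sigma$, let $\mathrm{DES}(\sigma)=\{i<n:\sigma_i>\sigma_{i+1}\}$, $\mathrm{desdif}(\sigma)=\sum_{i\in\mathrm{DES}(\sigma)}(\sigma_i-\sigma_{i+1})$, $\mathrm{res}(\sigma)=\sum_{i\in\mathrm{DES}(\sigma)}\#\{k<i:\sigma_i>\sigma_k>\sigma_{i+1}\}$, and $\mathrm{mad}(\sigma)=\mathrm{desdif}(\sigma)+\mathrm{res}(\sigma)$ (Clarke–Steingrímsson–Zeng). For a Dyck tiling $T$, $\operatorname{art}(T)=(\mathrm{area}(T)+\mathrm{tiles}(T))/2$, where area is the number of boxes and tiles the number of tiles. For $\lambda=Z_n$ the chord poset is an antichain, so its linear extensions are all of $S_n$. Dyck tilings: for Dyck paths $\mu$ weakly above $\lambda$ (paths with steps $(+1,\pm1)$ from $(-n,0)$ to $(n,0)$ at height $\ge0$), a Dyck tile is a ribbon tile (connected skew shape without a $2\times2$ square) whose leftmost and rightmost boxes are at equal height with no box below them; a Dyck tiling tiles the skew shape between $\lambda$ and $\mu$. Labeled trees $(\lambda,\sigma)$ (chords of $\lambda$ = segments between matching up/down steps, naturally labeled $1..n$ respecting nesting; $\sigma$ = standardization of the left endpoints $\ell_1,\dots,\ell_n$) correspond to sequences $p_1,\dots,p_n$, $0\le p_i\le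 2(i-1)$, $p_i=\#\{j<i:\ell_j<\ell_i\}+\#\{j<i:r_j<\ell_i\}$ ($r_j$ right endpoints). The spread of a path at column $s$ shifts points with $x\le s$ by $(-1,0)$, points with $x\ge s$ by $(+1,0)$, and points at $x=s$ also by $(0,+1)$; a tiling is spread by spreading its boundaries and tiles (tiles coordinatized by the path of lower corners of their boxes). A column $s$ of a tiling of $\lambda/\mu$ is eligible if $\mu$ has an up step ending at column $s$ and $\mu$'s point at $s$ is not the top corner of a one-box tile; the special column is the rightmost eligible one. ribbon-grow$(T,s)$ spreads $T$ at $s$ and, if the spread's special column $Q$ lies right of $s$, adds a ribbon of one-box tiles on top in columns strictly between $s$ and $Q$. $\operatorname{DTR}(p_1,\dots,p_n)$ is obtained from the empty tiling by applying ribbon-grow at column $p_k-(k-1)$ for $k=1,\dots,n$, and $\operatorname{DTR}(\lambda,\sigma)$ is this map applied to the sequence of the labeled tree $(\lambda,\sigma)$; its lower path is $\lambda$. *)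

theory Defs
  imports Complex_Main "HOL-Combinatorics.Permutations"
begin

section \<open>Dyck paths and Dyck tilings\<close>

text \<open>
  A lattice path is represented by the set of its lattice points. Paths of order \<open>n\<close> run from
  \<open>(-n, 0)\<close> to \<open>(n, 0)\<close>. Boxes are squares rotated by 45 degrees: the box with lower corner
  \<open>(x, y)\<close> has the other corners \<open>(x - 1, y + 1)\<close>, \<open>(x + 1, y + 1)\<close> and \<open>(x, y + 2)\<close>. A box is
  identified with its lower corner, and a tile with the set of its boxes, which for a ribbon tile
  is again the point set of a lattice path.
\<close>

type_synonym pt = "int \<times> int"

definition dyck_shaped :: "int \<Rightarrow> int \<Rightarrow> int \<Rightarrow> pt set \<Rightarrow> bool" where
  "dyck_shaped a b c P \<longleftrightarrow> a \<le> b \<and>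
     (\<exists>h. P = (\<lambda>x. (x, h x)) ` {a..b} \<and> h a = c \<and> h b = c \<and>
          (\<forall>x\<in>{a..<b}. \<bar>h (x + 1) - h x\<bar> = 1) \<and> (\<forall>x\<in>{a..b}. c \<le> h x))"

definition dyck_path :: "nat \<Rightarrow> pt set \<Rightarrow> bool" where
  "dyck_path n P \<longleftrightarrow> dyck_shaped (- int n) (int n) 0 P"

definition dyck_tile :: "pt set \<Rightarrow> bool" where
  "dyck_tile t \<longleftrightarrow> (\<exists>a b c. dyck_shaped a b c t)"

definition skew_boxes :: "pt set \<Rightarrow> pt set \<Rightarrow> pt set" where
  "skew_boxes lam mu =
     {(x, y). \<exists>a b. (x, a) \<in> lam \<and> (x, b) \<in> mu \<and> a \<le> y \<and> y + 2 \<le> b \<and> even (y - a)}"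

record tiling =
  lower :: "pt set"
  upper :: "pt set"
  tiles :: "pt set set"

definition dyck_tiling :: "nat \<Rightarrow> tiling \<Rightarrow> bool" where
  "dyck_tiling n T \<longleftrightarrow>
     dyck_path n (lower T) \<and> dyck_path n (upper T) \<and>
     (\<forall>x a b. (x, a) \<in> lower T \<longrightarrow> (x, b) \<in> upper T \<longrightarrow> a \<le> b) \<and>
     (\<forall>t\<in>tiles T. dyck_tile t) \<and>
     (\<forall>t\<in>tiles T. \<forall>u\<in>tiles T. t \<noteq> u \<longrightarrow> t \<inter> u = {}) \<and>
     \<Union> (tiles T) = skew_boxes (lower T) (upper T)"

definition area :: "tiling \<Rightarrow> nat" where
  "area T = card (skew_boxes (lower T) (upper T))"

definition art :: "tiling \<Rightarrow> real" where
  "art T = (real (area T) + real (card (tiles T))) / 2"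

section \<open>Ribbon growth\<close>

text \<open>The same operation spreads paths and (coordinatized by lower corners) tiles.\<close>

definition spread_points :: "int \<Rightarrow> pt set \<Rightarrow> pt set" where
  "spread_points s P =
     {(x - 1, y) | x y. (x, y) \<in> P \<and> x \<le> s} \<union>
     {(x + 1, y) | x y. (x, y) \<in> P \<and> s \<le> x} \<union>
     {(s, y + 1) | y. (s, y) \<in> P}"

definition spread :: "int \<Rightarrow> tiling \<Rightarrow> tiling" where
  "spread s T = \<lparr> lower = spread_points s (lower T), upper = spread_points s (upper T),
                  tiles = spread_points s ` tiles T \<rparr>"

text \<open>\<open>{(s, y - 2)}\<close> is the one-box tile whose top corner is \<open>(s, y)\<close>.\<close>

definition eligible :: "tiling \<Rightarrow> int \<Rightarrow> bool" where
  "eligible T s \<longleftrightarrow>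
     (\<exists>y. (s - 1, y - 1) \<in> upper T \<and> (s, y) \<in> upper T \<and> {(s, y - 2)} \<notin> tiles T)"

definition special_column :: "tiling \<Rightarrow> int" where
  "special_column T = Max {s. eligible T s}"

definition add_ribbon :: "int \<Rightarrow> int \<Rightarrow> tiling \<Rightarrow> tiling" where
  "add_ribbon s q T =
     T \<lparr> upper := (\<lambda>(x, y). (x, if s < x \<and> x < q then y + 2 else y)) ` upper T,
         tiles := tiles T \<union> {{(x, y)} | x y. (x, y) \<in> upper T \<and> s < x \<and> x < q} \<rparr>"

definition ribbon_grow :: "tiling \<Rightarrow> int \<Rightarrow> tiling" where
  "ribbon_grow T s =
     (let T' = spread s T; q = special_column T' in if s < q then add_ribbon s q T' else T')"

definition empty_tiling :: tiling where
  "empty_tiling = \<lparr> lower = {(0, 0)}, upper = {(0, 0)}, tiles = {} \<rparr>"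

text \<open>
  Lists are indexed from 0, so \<open>ps ! i\<close> is $p_{i+1}$ and its column is $p_{i+1} - i$.
\<close>

definition DTR_seq :: "nat list \<Rightarrow> tiling" where
  "DTR_seq ps = fold (\<lambda>i T. ribbon_grow T (int (ps ! i) - int i)) [0..<length ps] empty_tiling"

section \<open>Labeled trees\<close>

text \<open>
  A chord is a pair \<open>(l, r)\<close>, where \<open>l\<close> is the column in which its up step starts and \<open>r\<close> the
  column in which its down step starts. The geometric endpoints are the step midpoints
  \<open>l + 1/2\<close> and \<open>r + 1/2\<close>, so endpoints are compared as they should be.
\<close>

definition chords :: "pt set \<Rightarrow> (int \<times> int) set" where
  "chords lam = {(l, r). l < r \<and>
     (\<exists>y. (l, y) \<in> lam \<and> (l + 1, y + 1) \<in> lam \<and> (r, y + 1) \<in> lam \<and> (r + 1, y) \<in> lam \<and>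
          (\<forall>x z. l < x \<and> x \<le> r \<and> (x, z) \<in> lam \<longrightarrow> y < z))}"

text \<open>
  A labeled tree is given by \<open>lam\<close> and the standardization \<open>sg\<close> of the left endpoints of the
  chords labeled \<open>1, \<dots>, n\<close>: the chord labeled \<open>i\<close> has the \<open>sg i\<close>-th smallest left endpoint.
  Naturality of the labeling (a chord has a larger label than the chords it is nested in) is not
  needed to write down the definitions; it is vacuous for the zig-zag path.
\<close>

definition left_end :: "pt set \<Rightarrow> (nat \<Rightarrow> nat) \<Rightarrow> nat \<Rightarrow> int" where
  "left_end lam sg i = sorted_list_of_set (fst ` chords lam) ! (sg i - 1)"

definition right_end :: "pt set \<Rightarrow> (nat \<Rightarrow> nat) \<Rightarrow> nat \<Rightarrow> int" where
  "right_end lam sg i = (THE r. (left_end lam sg i, r) \<in> chords lam)"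

definition tree_seq :: "pt set \<Rightarrow> (nat \<Rightarrow> nat) \<Rightarrow> nat list" where
  "tree_seq lam sg =
     map (\<lambda>i. card {j. 1 \<le> j \<and> j < i \<and> left_end lam sg j < left_end lam sg i} +
              card {j. 1 \<le> j \<and> j < i \<and> right_end lam sg j < left_end lam sg i})
         [1..<card (chords lam) + 1]"

definition DTR :: "pt set \<Rightarrow> (nat \<Rightarrow> nat) \<Rightarrow> tiling" where
  "DTR lam sg = DTR_seq (tree_seq lam sg)"

section \<open>The zig-zag path\<close>

datatype step = U | D

primrec rise :: "step \<Rightarrow> int" where
  "rise U = 1"
| "rise D = -1"

definition path_of :: "step list \<Rightarrow> pt set" where
  "path_of w = (\<lambda>k. (int k - int (length w div 2), sum_list (map rise (take k w)))) ` {0..length w}"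

definition zigzag :: "nat \<Rightarrow> pt set" where
  "zigzag n = path_of (concat (replicate n [U, D]))"

section \<open>The statistic mad\<close>

definition DES :: "nat \<Rightarrow> (nat \<Rightarrow> nat) \<Rightarrow> nat set" where
  "DES n sg = {i. 1 \<le> i \<and> i < n \<and> sg i > sg (i + 1)}"

definition desdif :: "nat \<Rightarrow> (nat \<Rightarrow> nat) \<Rightarrow> nat" where
  "desdif n sg = (\<Sum>i\<in>DES n sg. sg i - sg (i + 1))"

definition res :: "nat \<Rightarrow> (nat \<Rightarrow> nat) \<Rightarrow> nat" where
  "res n sg = (\<Sum>i\<in>DES n sg. card {k. 1 \<le> k \<and> k < i \<and> sg i > sg k \<and> sg k > sg (i + 1)})"

definition mad :: "nat \<Rightarrow> (nat \<Rightarrow> nat) \<Rightarrow> nat" where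
  "mad n sg = desdif n sg + res n sg"

section \<open>Ribbon growth produces Dyck tilings\<close>

lemma mem_spread_points:
  "(x, y) \<in> spread_points s P \<longleftrightarrow>
     (if x < s then (x + 1, y) \<in> P else if x = s then (s, y - 1) \<in> P else (x - 1, y) \<in> P)"
proof -
  have "(x, y) \<in> spread_points s P \<longleftrightarrow>
     (x + 1, y) \<in> P \<and> x + 1 \<le> s \<or> (x - 1, y) \<in> P \<and> s \<le> x - 1 \<or> x = s \<and> (s, y - 1) \<in> P"
    unfolding spread_points_def by (auto simp: algebra_simps) (force+)?
  then show ?thesis by (cases x s rule: linorder_cases) auto
qed

lemma mem_graph: "(x, y) \<in> (\<lambda>x. (x, h x)) ` A \<longleftrightarrow> x \<in> A \<and> y = h x"
  by auto

lemma dyck_shaped_spread: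
  assumes "dyck_shaped a b c P" "a \<le> s" "s \<le> b"
  shows "dyck_shaped (a - 1) (b + 1) c (spread_points s P)"
proof -
  obtain h where P: "P = (\<lambda>x. (x, h x)) ` {a..b}" and ab: "h a = c" "h b = c"
    and st: "\<And>x. a \<le> x \<Longrightarrow> x < b \<Longrightarrow> \<bar>h (x + 1) - h x\<bar> = 1"
    and ge: "\<And>x. a \<le> x \<Longrightarrow> x \<le> b \<Longrightarrow> c \<le> h x"
    using assms(1) unfolding dyck_shaped_def by auto
  define k where "k x = (if x < s then h (x + 1) else if x = s then h s + 1 else h (x - 1))" for x
  have "spread_points s P = (\<lambda>x. (x, k x)) ` {a - 1..b + 1}"
  proof (rule set_eqI)
    fix p :: pt
    show "p \<in> spread_points s P \<longleftrightarrow> p \<in> (\<lambda>x. (x, k x)) ` {a - 1..b + 1}"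
      using assms(2,3)
      by (cases p) (auto simp: mem_spread_points P mem_graph k_def)
  qed
  moreover have "k (a - 1) = c" "k (b + 1) = c"
    using ab assms(2,3) by (auto simp: k_def)
  moreover have "\<bar>k (x + 1) - k x\<bar> = 1" if "x \<in> {a - 1..<b + 1}" for x
  proof -
    consider "x + 1 < s" | "x + 1 = s" | "x = s" | "s < x" by linarith
    then show ?thesis
    proof cases
      case 1
      then show ?thesis using that assms(3) st[of "x + 1"] by (auto simp: k_def algebra_simps)
    next
      case 4
      then show ?thesis using that assms(2) st[of "x - 1"] by (auto simp: k_def)
    qed (auto simp: k_def)
  qed
  moreover have "c \<le> k x" if "x \<in> {a - 1..b + 1}" for x
  proof (cases x s rule: linorder_cases)
    case less
    then show ?thesis using that assms(3) ge[of "x + 1"] by (auto simp: k_def)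
  next
    case equal
    then show ?thesis using assms(2,3) ge[of s] by (auto simp: k_def)
  next
    case greater
    then show ?thesis using that assms(2) ge[of "x - 1"] by (auto simp: k_def)
  qed
  ultimately show ?thesis using assms unfolding dyck_shaped_def by auto
qed

lemma dyck_shaped_shift:
  assumes "dyck_shaped a b c P"
  shows "dyck_shaped (a + d) (b + d) c ((\<lambda>(x, y). (x + d, y)) ` P)"
proof -
  obtain h where P: "P = (\<lambda>x. (x, h x)) ` {a..b}" and h: "h a = c" "h b = c"
    "\<forall>x\<in>{a..<b}. \<bar>h (x + 1) - h x\<bar> = 1" "\<forall>x\<in>{a..b}. c \<le> h x"
    using assms unfolding dyck_shaped_def by auto
  have "(\<lambda>(x, y). (x + d, y)) ` P = (\<lambda>x. (x + d, h x)) ` {a..b}"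
    unfolding P by (auto simp: image_image)
  also have "\<dots> = (\<lambda>x. (x, h (x - d))) ` ((\<lambda>x. x + d) ` {a..b})"
    by (simp only: image_image add_diff_cancel_right')
  also have "(\<lambda>x. x + d) ` {a..b} = {a + d..b + d}"
    by simp
  finally have "(\<lambda>(x, y). (x + d, y)) ` P = (\<lambda>x. (x, h (x - d))) ` {a + d..b + d}" .
  moreover have "\<bar>h (x + 1 - d) - h (x - d)\<bar> = 1" if "x \<in> {a + d..<b + d}" for x
    using h(3)[rule_format, of "x - d"] that by (auto simp: algebra_simps)
  moreover have "c \<le> h (x - d)" if "x \<in> {a + d..b + d}" for x
    using h(4)[rule_format, of "x - d"] that by auto
  ultimately show ?thesis
    using assms h(1,2) unfolding dyck_shaped_def by (auto intro!: exI[of _ "\<lambda>x. h (x - d)"])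
qed

lemma dyck_shaped_bounds: "dyck_shaped a b c P \<Longrightarrow> (x, y) \<in> P \<Longrightarrow> a \<le> x \<and> x \<le> b"
  unfolding dyck_shaped_def by auto

lemma mem_shift: "(x, y) \<in> (\<lambda>(x, y). (x + d, y)) ` t \<longleftrightarrow> (x - d, y) \<in> t" for x y d :: int
  by force

lemma dyck_tile_spread:
  assumes "dyck_tile t"
  shows "dyck_tile (spread_points s t)"
proof -
  obtain a b c where t: "dyck_shaped a b c t"
    using assms unfolding dyck_tile_def by auto
  note bnd = dyck_shaped_bounds[OF t]
  consider "a \<le> s" "s \<le> b" | "s < a" | "b < s" by linarith
  then show ?thesis
  proof cases
    case 1
    then show ?thesis using dyck_shaped_spread[OF t] unfolding dyck_tile_def by blast
  next
    case 2
    have "(x, y) \<in> spread_points s t \<longleftrightarrow> (x, y) \<in> (\<lambda>(x, y). (x + 1, y)) ` t" for x y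
      using bnd[of "x - 1" y] bnd[of "x + 1" y] bnd[of s "y - 1"] 2
      unfolding mem_shift mem_spread_points by (auto split: if_splits)
    then have "spread_points s t = (\<lambda>(x, y). (x + 1, y)) ` t"
      by (simp add: set_eq_iff)
    then show ?thesis using dyck_shaped_shift[OF t, of 1] unfolding dyck_tile_def by auto
  next
    case 3
    have "(x, y) \<in> spread_points s t \<longleftrightarrow> (x, y) \<in> (\<lambda>(x, y). (x + (-1), y)) ` t" for x y
      using bnd[of "x - 1" y] bnd[of "x + 1" y] bnd[of s "y - 1"] 3
      unfolding mem_shift mem_spread_points by (auto split: if_splits)
    then have "spread_points s t = (\<lambda>(x, y). (x + (-1), y)) ` t"
      by (simp add: set_eq_iff)
    then show ?thesis using dyck_shaped_shift[OF t, of "-1"] unfolding dyck_tile_def by metis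
  qed
qed

lemma skew_boxes_spread:
  "skew_boxes (spread_points s lam) (spread_points s mu) = spread_points s (skew_boxes lam mu)"
proof (rule set_eqI)
  fix p :: pt
  obtain x y where p: "p = (x, y)" by fastforce
  have sb: "(x, y) \<in> skew_boxes lam mu \<longleftrightarrow>
    (\<exists>a b. (x, a) \<in> lam \<and> (x, b) \<in> mu \<and> a \<le> y \<and> y + 2 \<le> b \<and> even (y - a))" for x y lam mu
    unfolding skew_boxes_def by simp
  show "p \<in> skew_boxes (spread_points s lam) (spread_points s mu) \<longleftrightarrow>
        p \<in> spread_points s (skew_boxes lam mu)"
  proof (cases x s rule: linorder_cases)
    case equal
    have "(\<exists>a b. (s, a - 1) \<in> lam \<and> (s, b - 1) \<in> mu \<and> a \<le> y \<and> y + 2 \<le> b \<and> even (y - a)) \<longleftrightarrow>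
      (\<exists>a b. (s, a) \<in> lam \<and> (s, b) \<in> mu \<and> a \<le> y - 1 \<and> y - 1 + 2 \<le> b \<and> even (y - 1 - a))"
      (is "?L \<longleftrightarrow> ?R")
    proof
      assume ?L
      then obtain a b where "(s, a - 1) \<in> lam" "(s, b - 1) \<in> mu" "a \<le> y" "y + 2 \<le> b" "even (y - a)"
        by blast
      then show ?R by (intro exI[of _ "a - 1"] exI[of _ "b - 1"]) auto
    next
      assume ?R
      then obtain a b where "(s, a) \<in> lam" "(s, b) \<in> mu" "a \<le> y - 1" "y - 1 + 2 \<le> b"
        "even (y - 1 - a)"
        by blast
      then show ?L by (intro exI[of _ "a + 1"] exI[of _ "b + 1"]) (auto simp: algebra_simps)
    qed
    then show ?thesis using equal by (simp add: p sb mem_spread_points)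
  qed (simp_all add: p sb mem_spread_points)
qed

lemma spread_points_Union: "spread_points s (\<Union> A) = \<Union> (spread_points s ` A)"
  unfolding spread_points_def by auto

lemma spread_points_Int: "spread_points s (A \<inter> B) = spread_points s A \<inter> spread_points s B"
  by (auto simp: mem_spread_points split: if_splits)

lemma dyck_tiling_spread:
  assumes T: "dyck_tiling n T" and s: "\<bar>s\<bar> \<le> int n"
  shows "dyck_tiling (Suc n) (spread s T)"
proof -
  note T' = T[unfolded dyck_tiling_def]
  from T' have le: "\<And>x a b. (x, a) \<in> lower T \<Longrightarrow> (x, b) \<in> upper T \<Longrightarrow> a \<le> b"
    by (elim conjE) metis
  from T' have ti: "\<And>t. t \<in> tiles T \<Longrightarrow> dyck_tile t" by (elim conjE) metis
  from T' have di: "\<And>t u. t \<in> tiles T \<Longrightarrow> u \<in> tiles T \<Longrightarrow> t \<noteq> u \<Longrightarrow> t \<inter> u = {}"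
    by (elim conjE) metis
  from T' have un: "\<Union> (tiles T) = skew_boxes (lower T) (upper T)" by (elim conjE)
  have path: "dyck_path (Suc n) (spread_points s P)" if "dyck_path n P" for P
  proof -
    have "dyck_shaped (- int n - 1) (int n + 1) 0 (spread_points s P)"
      using that s by (intro dyck_shaped_spread) (auto simp: dyck_path_def)
    moreover have "- int n - 1 = - int (Suc n)" "int n + 1 = int (Suc n)" by simp_all
    ultimately show ?thesis unfolding dyck_path_def by (simp only:)
  qed
  have lo: "dyck_path (Suc n) (lower (spread s T))" and mu: "dyck_path (Suc n) (upper (spread s T))"
    using T' path by (simp_all add: spread_def)
  have le': "a \<le> b" if "(x, a) \<in> lower (spread s T)" "(x, b) \<in> upper (spread s T)" for x a b
    using that le[of "x + 1" a b] le[of s "a - 1" "b - 1"] le[of "x - 1" a b]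
    by (auto simp: spread_def mem_spread_points split: if_splits)
  have ti': "dyck_tile t" if "t \<in> tiles (spread s T)" for t
    using that ti dyck_tile_spread by (auto simp: spread_def)
  have di': "t \<inter> u = {}" if "t \<in> tiles (spread s T)" "u \<in> tiles (spread s T)" "t \<noteq> u" for t u
  proof -
    obtain t' u' where tu: "t' \<in> tiles T" "u' \<in> tiles T" "t = spread_points s t'" "u = spread_points s u'"
      using \<open>t \<in> _\<close> \<open>u \<in> _\<close> by (auto simp: spread_def)
    then have "t' \<inter> u' = {}" using di \<open>t \<noteq> u\<close> by blast
    moreover have "spread_points s {} = {}" by (simp add: spread_points_def)
    ultimately show ?thesis using tu spread_points_Int[of s t' u'] by simp
  qed
  have un': "\<Union> (tiles (spread s T)) = skew_boxes (lower (spread s T)) (upper (spread s T))"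
    by (simp add: spread_def skew_boxes_spread flip: spread_points_Union un)
  show ?thesis
    unfolding dyck_tiling_def
    by (intro conjI allI impI ballI) (fact lo mu le' ti' di' un')+
qed

lemma special_column_spread:
  assumes T: "dyck_tiling n T" and s: "\<bar>s\<bar> \<le> int n"
  shows "eligible (spread s T) (special_column (spread s T))" "s \<le> special_column (spread s T)"
proof -
  let ?T = "spread s T"
  have "dyck_path n (upper T)" using T unfolding dyck_tiling_def by simp
  then obtain h where h: "upper T = (\<lambda>x. (x, h x)) ` {- int n..int n}"
    unfolding dyck_path_def dyck_shaped_def by auto
  then have sy: "(s, h s) \<in> upper T" using s unfolding h mem_graph by auto
  have "{(s, h s + 1 - 2)} \<noteq> spread_points s t" for t
  proof
    assume eq: "{(s, h s + 1 - 2)} = spread_points s t"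
    then have "(s, h s + 1 - 2) \<in> spread_points s t" by auto
    then have "(s - 1, h s + 1 - 2 - 1) \<in> spread_points s t" by (simp add: mem_spread_points)
    then show False unfolding eq[symmetric] by simp
  qed
  then have "eligible ?T s"
    using sy unfolding eligible_def
    by (intro exI[of _ "h s + 1"]) (auto simp: spread_def mem_spread_points)
  moreover have "{c. eligible ?T c} \<subseteq> {- int (Suc n)..int (Suc n)}"
  proof -
    have "dyck_path (Suc n) (upper ?T)"
      using dyck_tiling_spread[OF T s] unfolding dyck_tiling_def by simp
    then show ?thesis unfolding dyck_path_def eligible_def by (auto dest: dyck_shaped_bounds)
  qed
  then have "finite {c. eligible ?T c}" using finite_subset by blast
  ultimately show "eligible ?T (special_column ?T)" "s \<le> special_column ?T"
    using Max_in[of "{c. eligible ?T c}"] Max_ge[of "{c. eligible ?T c}" s]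
    unfolding special_column_def by auto
qed

lemma dyck_tile_singleton: "dyck_tile {(x, y)}"
proof -
  have "dyck_shaped x x y {(x, y)}"
    unfolding dyck_shaped_def by (auto intro!: exI[of _ "\<lambda>_. y"])
  then show ?thesis unfolding dyck_tile_def by blast
qed

lemma dyck_tiling_add_ribbon:
  assumes T: "dyck_tiling n T" and sq: "s < q"
    and up: "(q - 1, y - 1) \<in> upper T" "(q, y) \<in> upper T"
    and down: "(s, z) \<in> upper T" "(s + 1, z - 1) \<in> upper T"
  shows "dyck_tiling n (add_ribbon s q T)"
proof -
  let ?n = "int n" and ?T = "add_ribbon s q T"
  note T' = T[unfolded dyck_tiling_def]
  from T' have lo: "dyck_path n (lower T)" by (elim conjE)
  from T' have mu: "dyck_path n (upper T)" by (elim conjE)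
  from T' have le: "\<And>x a b. (x, a) \<in> lower T \<Longrightarrow> (x, b) \<in> upper T \<Longrightarrow> a \<le> b"
    by (elim conjE) metis
  from T' have ti: "\<And>t. t \<in> tiles T \<Longrightarrow> dyck_tile t" by (elim conjE) metis
  from T' have di: "\<And>t u. t \<in> tiles T \<Longrightarrow> u \<in> tiles T \<Longrightarrow> t \<noteq> u \<Longrightarrow> t \<inter> u = {}"
    by (elim conjE) metis
  from T' have un: "\<Union> (tiles T) = skew_boxes (lower T) (upper T)" by (elim conjE)
  obtain g where lower: "lower T = (\<lambda>x. (x, g x)) ` {- ?n..?n}" and g: "g (- ?n) = 0"
    "\<And>x. - ?n \<le> x \<Longrightarrow> x < ?n \<Longrightarrow> \<bar>g (x + 1) - g x\<bar> = 1"
    using lo unfolding dyck_path_def dyck_shaped_def by auto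
  obtain h where upper: "upper T = (\<lambda>x. (x, h x)) ` {- ?n..?n}" and h: "h (- ?n) = 0" "h ?n = 0"
    "\<And>x. - ?n \<le> x \<Longrightarrow> x < ?n \<Longrightarrow> \<bar>h (x + 1) - h x\<bar> = 1" "\<And>x. - ?n \<le> x \<Longrightarrow> x \<le> ?n \<Longrightarrow> 0 \<le> h x"
    using mu unfolding dyck_path_def dyck_shaped_def by auto
  have hq: "h q = h (q - 1) + 1" "q \<le> ?n" and hs: "h (s + 1) = h s - 1" "- ?n \<le> s"
    using up down unfolding upper by auto
  define k where "k x = (if s < x \<and> x < q then h x + 2 else h x)" for x
  have upper': "upper ?T = (\<lambda>x. (x, k x)) ` {- ?n..?n}"
    unfolding add_ribbon_def by (auto simp: upper k_def image_image)
  have k: "\<bar>k (x + 1) - k x\<bar> = 1" if "- ?n \<le> x" "x < ?n" for x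
  proof -
    consider "x < s \<or> q \<le> x" | "x = s" | "s < x" "x + 1 < q" | "s < x" "x + 1 = q"
      by linarith
    then show ?thesis
    proof cases
      case 1
      then show ?thesis using h(3)[OF that] sq by (auto simp: k_def)
    next
      case 2
      have "s + 1 \<noteq> q" using hq hs by auto
      then show ?thesis using 2 hs sq by (auto simp: k_def)
    next
      case 3
      then show ?thesis using h(3)[OF that] by (auto simp: k_def)
    next
      case 4
      then have "h (x + 1) = h x + 1" using hq by auto
      then show ?thesis using 4 by (auto simp: k_def)
    qed
  qed
  have goal_mu: "dyck_path n (upper ?T)"
    unfolding dyck_path_def dyck_shaped_def upper'
    using h(1,2) k hq(2) hs(2) h(4) by (intro conjI exI[of _ k]) (auto simp: k_def intro: add_nonneg_nonneg)
  have parity: "even (h x - g x)" if "- ?n \<le> x" "x \<le> ?n" for x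
    using that
  proof (induction x rule: int_ge_induct)
    case base
    then show ?case using g(1) h(1) by simp
  next
    case (step x)
    then have "\<bar>g (x + 1) - g x\<bar> = 1" "\<bar>h (x + 1) - h x\<bar> = 1" "even (h x - g x)"
      using g(2)[of x] h(3)[of x] by auto
    then show ?case by presburger
  qed
  have upper_mem: "(x, y) \<in> upper T \<longleftrightarrow> - ?n \<le> x \<and> x \<le> ?n \<and> y = h x" for x y
    by (auto simp: upper)
  have gh: "g x \<le> h x" if "- ?n \<le> x" "x \<le> ?n" for x
    using le[of x "g x" "h x"] that by (auto simp: lower upper)
  then have goal_le: "a \<le> b" if "(x, a) \<in> lower ?T" "(x, b) \<in> upper ?T" for x a b
    using that unfolding upper' by (fastforce simp: add_ribbon_def lower k_def)
  have sb: "(x, y) \<in> skew_boxes (lower T) (upper T) \<longleftrightarrow>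
      - ?n \<le> x \<and> x \<le> ?n \<and> g x \<le> y \<and> y + 2 \<le> h x \<and> even (y - g x)" for x y
    unfolding skew_boxes_def by (auto simp add: lower upper mem_graph)
  have sb': "(x, y) \<in> skew_boxes (lower ?T) (upper ?T) \<longleftrightarrow>
      - ?n \<le> x \<and> x \<le> ?n \<and> g x \<le> y \<and> y + 2 \<le> k x \<and> even (y - g x)" for x y
    unfolding skew_boxes_def upper' by (simp add: add_ribbon_def lower mem_graph) blast
  let ?R = "{(x, y). (x, y) \<in> upper T \<and> s < x \<and> x < q}"
  have boxes: "skew_boxes (lower ?T) (upper ?T) = skew_boxes (lower T) (upper T) \<union> ?R"
  proof (rule set_eqI)
    fix p :: pt
    obtain x y where p: "p = (x, y)" by fastforce
    have "y \<le> h x \<Longrightarrow> even (y - g x) \<Longrightarrow> - ?n \<le> x \<Longrightarrow> x \<le> ?n \<Longrightarrow> y = h x \<or> y + 2 \<le> h x"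
      using parity[of x] by presburger
    then show "p \<in> skew_boxes (lower ?T) (upper ?T) \<longleftrightarrow>
        p \<in> skew_boxes (lower T) (upper T) \<union> ?R"
      using parity[of x] gh[of x] by (auto simp: p sb sb' k_def upper_mem)
  qed
  have tiles': "tiles ?T = tiles T \<union> {{(x, y)} | x y. (x, y) \<in> ?R}"
    by (auto simp: add_ribbon_def)
  have "\<Union> (tiles ?T) = \<Union> (tiles T) \<union> ?R"
    unfolding tiles' by blast
  then have goal_un: "\<Union> (tiles ?T) = skew_boxes (lower ?T) (upper ?T)"
    by (simp only: boxes un)
  have disj: "(x, y) \<notin> t" if "t \<in> tiles T" "(x, y) \<in> ?R" for t x y
  proof
    assume "(x, y) \<in> t"
    then have "(x, y) \<in> skew_boxes (lower T) (upper T)" using that(1) un by blast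
    then show False using that(2) by (auto simp: sb upper_mem)
  qed
  have goal_di: "t \<inter> u = {}" if tu: "t \<in> tiles ?T" "u \<in> tiles ?T" "t \<noteq> u" for t u
  proof -
    consider "t \<in> tiles T" "u \<in> tiles T"
      | x y where "t \<in> tiles T" "u = {(x, y)}" "(x, y) \<in> ?R"
      | x y where "u \<in> tiles T" "t = {(x, y)}" "(x, y) \<in> ?R"
      | x y x' y' where "t = {(x, y)}" "u = {(x', y')}"
      using tu(1,2) unfolding tiles' by blast
    then show ?thesis
    proof cases
      case 1
      then show ?thesis using di tu(3) by simp
    next
      case 2
      then show ?thesis using disj by simp
    next
      case 3
      then show ?thesis using disj by simp
    next
      case 4
      then show ?thesis using tu(3) by simp
    qed
  qed
  have goal_ti: "dyck_tile t" if "t \<in> tiles ?T" for t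
    using that ti dyck_tile_singleton unfolding tiles' by auto
  have goal_lo: "dyck_path n (lower ?T)" using lo by (simp add: add_ribbon_def)
  show ?thesis
    unfolding dyck_tiling_def
    by (intro conjI allI impI ballI) (fact goal_lo goal_mu goal_le goal_ti goal_di goal_un)+
qed

lemma dyck_tiling_ribbon_grow:
  assumes T: "dyck_tiling n T" and s: "\<bar>s\<bar> \<le> int n"
  shows "dyck_tiling (Suc n) (ribbon_grow T s)"
proof -
  let ?T = "spread s T"
  let ?q = "special_column ?T"
  have T': "dyck_tiling (Suc n) ?T" using dyck_tiling_spread[OF T s] .
  have "dyck_path n (upper T)" using T unfolding dyck_tiling_def by simp
  then obtain h where "upper T = (\<lambda>x. (x, h x)) ` {- int n..int n}"
    unfolding dyck_path_def dyck_shaped_def by auto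
  then have "(s, h s) \<in> upper T"
    using s by (auto simp: mem_graph)
  then obtain z where "(s, z) \<in> upper T" by blast
  then have "(s, z + 1) \<in> upper ?T" "(s + 1, z + 1 - 1) \<in> upper ?T"
    by (simp_all add: spread_def mem_spread_points)
  moreover obtain y where "(?q - 1, y - 1) \<in> upper ?T" "(?q, y) \<in> upper ?T"
    using special_column_spread(1)[OF T s] unfolding eligible_def by blast
  ultimately have "dyck_tiling (Suc n) (add_ribbon s ?q ?T)" if "s < ?q"
    using dyck_tiling_add_ribbon[OF T' that] by blast
  then show ?thesis using T' by (simp add: ribbon_grow_def Let_def)
qed

lemma dyck_tiling_DTR_seq:
  assumes "\<And>i. i < length ps \<Longrightarrow> ps ! i \<le> 2 * i"
  shows "dyck_tiling (length ps) (DTR_seq ps)"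
proof -
  have "dyck_tiling m (fold (\<lambda>i T. ribbon_grow T (int (ps ! i) - int i)) [0..<m] empty_tiling)"
    if "m \<le> length ps" for m
    using that
  proof (induction m)
    case 0
    have "dyck_path 0 {(0, 0)}"
      unfolding dyck_path_def dyck_shaped_def by (auto intro!: exI[of _ "\<lambda>_. 0"])
    then show ?case by (auto simp: dyck_tiling_def empty_tiling_def skew_boxes_def)
  next
    case (Suc m)
    then have "\<bar>int (ps ! m) - int m\<bar> \<le> int m"
      using assms[of m] by simp
    then show ?case using Suc dyck_tiling_ribbon_grow by simp
  qed
  then show ?thesis by (simp add: DTR_seq_def)
qed

end

theory Submission
  imports Defs
begin

text \<open>
  Right after inserting at column \<open>s\<close>, the special column is \<open>s\<close> itself. Hence the next insertion, at
  column \<open>t\<close>, adds a ribbon exactly when \<open>t < s\<close>, and this ribbon has \<open>s - t\<close> boxes. For the zig-zag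
  path this happens exactly at the descents of the permutation; there \<open>s - t\<close> is one plus twice the
  number of earlier values between the two letters. Spreading adds the number of boxes in the
  spread column to \<open>art\<close>: the number of earlier descents whose two letters enclose the inserted value.
  Charging the latter to the descents, each descent collects its \<open>res\<close> twice, one, and the number
  of later values between its two letters, that is, its height plus its \<open>res\<close>.
\<close>

section \<open>Spreading\<close>

text \<open>Each point can be read off from one image: shifted left, raised on column
  \<open>s\<close>, or shifted right. Injectivity keeps the number of tiles unchanged under
  spreading.\<close>

lemma inj_spread_points: "inj (spread_points s)"
proof (rule injI)
  fix P Q assume eq: "spread_points s P = spread_points s Q"
  have "(x, y) \<in> P \<longleftrightarrow> (x, y) \<in> Q" for x y
  proof (cases x s rule: linorder_cases)
    case less
    then show ?thesis
      using arg_cong[OF eq, of "\<lambda>A. (x - 1, y) \<in> A"] by (simp add: mem_spread_points)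
  next
    case equal
    then show ?thesis
      using arg_cong[OF eq, of "\<lambda>A. (s, y + 1) \<in> A"] by (simp add: mem_spread_points)
  next
    case greater
    then show ?thesis
      using arg_cong[OF eq, of "\<lambda>A. (x + 1, y) \<in> A"] by (simp add: mem_spread_points)
  qed
  then show "P = Q" by auto
qed

lemma card_Un_disjoint3:
  assumes "finite A" "finite B" "finite C" "A \<inter> B = {}" "A \<inter> C = {}" "B \<inter> C = {}"
  shows "card (A \<union> B \<union> C) = card A + card B + card C"
  using assms by (simp add: card_Un_disjoint Int_Un_distrib2)

lemma finite_column: "finite P \<Longrightarrow> finite {y. (x, y) \<in> P}"
  using finite_vimageI[of P "Pair x"] by (simp add: vimage_def inj_on_def)

text \<open>A point off column \<open>s\<close> has a single image, while a point on it has three: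
  hence two extra points for each.\<close>

lemma card_spread_points:
  assumes "finite P"
  shows "card (spread_points s P) = card P + 2 * card {y. (s, y) \<in> P}"
proof -
  let ?L = "{p \<in> P. fst p < s}" and ?R = "{p \<in> P. s < fst p}" and ?C = "{y. (s, y) \<in> P}"
  have fin: "finite ?C"
    using finite_column[OF assms] .
  have "spread_points s P =
    (\<lambda>(x, y). (x - 1, y)) ` ?L \<union> (\<lambda>(x, y). (x + 1, y)) ` ?R \<union>
    (Pair (s - 1) ` ?C \<union> Pair (s + 1) ` ?C \<union> (\<lambda>y. (s, y + 1)) ` ?C)"
    (is "_ = ?l \<union> ?r \<union> (?a \<union> ?b \<union> ?c)")
    unfolding spread_points_def by (force simp: order_le_less)
  moreover have "card (?l \<union> ?r \<union> (?a \<union> ?b \<union> ?c)) = card ?l + card ?r + (card ?a + card ?b + card ?c)"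
  proof -
    have "card (?a \<union> ?b \<union> ?c) = card ?a + card ?b + card ?c"
      using fin by (intro card_Un_disjoint3) auto
    moreover have "card (?l \<union> ?r \<union> (?a \<union> ?b \<union> ?c)) = card ?l + card ?r + card (?a \<union> ?b \<union> ?c)"
      using assms fin by (intro card_Un_disjoint3) auto
    ultimately show ?thesis by simp
  qed
  moreover have "card ?l = card ?L" "card ?r = card ?R"
    by (auto intro!: card_image inj_onI)
  moreover have "card ?a = card ?C" "card ?b = card ?C" "card ?c = card ?C"
    by (auto intro!: card_image inj_onI)
  moreover have "card P = card ?L + card ?R + card ?C"
  proof -
    have "P = ?L \<union> ?R \<union> Pair s ` ?C" by force
    also have "card \<dots> = card ?L + card ?R + card (Pair s ` ?C)"
      using assms fin by (intro card_Un_disjoint3) auto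
    finally show ?thesis by (simp add: card_image inj_on_def)
  qed
  ultimately show ?thesis by simp
qed

text \<open>The amount by which spreading at \<open>x\<close> raises \<open>art\<close>; it is
  tracked for all columns because later insertions may hit any valley.\<close>

definition col :: "tiling \<Rightarrow> int \<Rightarrow> nat" where
  "col T x = card {y. (x, y) \<in> \<Union> (tiles T)}"

lemma Union_tiles_spread: "\<Union> (tiles (spread s T)) = spread_points s (\<Union> (tiles T))"
  by (simp add: spread_def spread_points_Union)

text \<open>Column \<open>s\<close> is tripled into \<open>s - 1\<close>, \<open>s\<close>,
  \<open>s + 1\<close>; the other columns are only translated.\<close>

lemma col_spread:
  "col (spread s T) x = col T (if x < s then x + 1 else if x = s then s else x - 1)"
proof -
  have "{y. (s, y - 1) \<in> A} = (\<lambda>y. y + 1) ` {y. (s, y) \<in> A}" for A :: "pt set"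
    by (auto simp: image_iff intro!: exI[of _ "_ - 1"])
  then have "card {y. (s, y - 1) \<in> A} = card {y. (s, y) \<in> A}" for A :: "pt set"
    by (simp add: card_image)
  then show ?thesis
    unfolding col_def Union_tiles_spread by (simp add: mem_spread_points del: Union_iff)
qed

section \<open>Paths as graphs of functions, and finiteness of tilings\<close>

lemma dyck_path_graph:
  assumes "dyck_path n P"
  obtains h where "P = (\<lambda>x. (x, h x)) ` {- int n..int n}"
  using assms unfolding dyck_path_def dyck_shaped_def by auto

lemma dyck_path_fun:
  assumes "dyck_path n P" "(x, a) \<in> P" "(x, b) \<in> P"
  shows "a = b"
  using dyck_path_graph[OF assms(1)] assms(2,3) by (metis mem_graph)

lemma dyck_path_total:
  assumes "dyck_path n P" "\<bar>x\<bar> \<le> int n"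
  obtains y where "(x, y) \<in> P"
proof -
  obtain h where "P = (\<lambda>x. (x, h x)) ` {- int n..int n}" using dyck_path_graph[OF assms(1)] .
  then have "(x, h x) \<in> P" using assms(2) by (auto simp: mem_graph)
  then show thesis by (rule that)
qed

lemma dyck_tilingD:
  assumes "dyck_tiling n T"
  shows "dyck_path n (lower T)" "dyck_path n (upper T)"
    "\<Union> (tiles T) = skew_boxes (lower T) (upper T)"
  using assms unfolding dyck_tiling_def by - (elim conjE, assumption)+

lemma finite_Union_tiles:
  assumes "dyck_tiling n T"
  shows "finite (\<Union> (tiles T))"
proof -
  have "finite (lower T)" "finite (upper T)"
    using dyck_tilingD(1,2)[OF assms] by (auto elim!: dyck_path_graph)
  then have "finite (\<Union>p\<in>lower T. \<Union>q\<in>upper T. {fst p} \<times> {snd p..snd q})" by auto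
  moreover have "skew_boxes (lower T) (upper T) \<subseteq>
      (\<Union>p\<in>lower T. \<Union>q\<in>upper T. {fst p} \<times> {snd p..snd q})"
    unfolding skew_boxes_def by force
  ultimately show ?thesis unfolding dyck_tilingD(3)[OF assms] by (rule finite_subset[rotated])
qed

lemma finite_tiles: "dyck_tiling n T \<Longrightarrow> finite (tiles T)"
  using finite_Union_tiles finite_UnionD by blast

lemma box_below_upper:
  assumes "dyck_tiling n T" "(x, y) \<in> \<Union> (tiles T)" "(x, b) \<in> upper T"
  shows "y + 2 \<le> b"
proof -
  obtain b' where "(x, b') \<in> upper T" "y + 2 \<le> b'"
    using assms(2) unfolding dyck_tilingD(3)[OF assms(1)] skew_boxes_def by auto
  then show ?thesis using dyck_path_fun[OF dyck_tilingD(2)[OF assms(1)]] assms(3) by metis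
qed

lemma area_eq: "dyck_tiling n T \<Longrightarrow> area T = card (\<Union> (tiles T))"
  by (simp add: area_def dyck_tilingD(3))

text \<open>The number of tiles stays fixed and the area grows by two for each box in column
  \<open>s\<close>, which \<open>art\<close> halves.\<close>

lemma art_spread:
  assumes T: "dyck_tiling n T" and s: "\<bar>s\<bar> \<le> int n"
  shows "art (spread s T) = art T + real (col T s)"
proof -
  have "card (tiles (spread s T)) = card (tiles T)"
    by (simp add: spread_def card_image inj_on_subset[OF inj_spread_points])
  moreover have "area (spread s T) = area T + 2 * col T s"
    unfolding area_eq[OF T] area_eq[OF dyck_tiling_spread[OF T s]] Union_tiles_spread col_def
    by (rule card_spread_points) (rule finite_Union_tiles[OF T])
  ultimately show ?thesis by (simp add: art_def field_simps)
qed

section \<open>Adding a ribbon\<close>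

text \<open>The new boxes have their lower corners on the upper path, one in each column strictly
  between \<open>s\<close> and \<open>q\<close>. Old boxes have their top corners at or below that
  path, so nothing overlaps.\<close>

lemma add_ribbon_boxes:
  fixes T s q
  defines "R \<equiv> {(x, y). (x, y) \<in> upper T \<and> s < x \<and> x < q}"
  assumes T: "dyck_tiling n T" and sq: "- int n \<le> s" "q \<le> int n" "s < q"
  shows "\<Union> (tiles (add_ribbon s q T)) = \<Union> (tiles T) \<union> R"
    and "tiles (add_ribbon s q T) = tiles T \<union> (\<lambda>p. {p}) ` R"
    and "\<Union> (tiles T) \<inter> R = {}" "finite R" "int (card R) = q - s - 1"
    and "card {y. (x, y) \<in> R} = (if s < x \<and> x < q then 1 else 0)"
proof -
  show tiles: "tiles (add_ribbon s q T) = tiles T \<union> (\<lambda>p. {p}) ` R"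
    unfolding add_ribbon_def R_def by auto
  show "\<Union> (tiles (add_ribbon s q T)) = \<Union> (tiles T) \<union> R"
    unfolding tiles by blast
  show "\<Union> (tiles T) \<inter> R = {}"
    using box_below_upper[OF T] unfolding R_def by fastforce
  obtain h where h: "upper T = (\<lambda>x. (x, h x)) ` {- int n..int n}"
    using dyck_path_graph[OF dyck_tilingD(2)[OF T]] .
  have R: "R = (\<lambda>x. (x, h x)) ` {s<..<q}"
    unfolding R_def h using sq by auto
  show "finite R" unfolding R by simp
  have "card R = card {s<..<q}" unfolding R by (rule card_image) (simp add: inj_on_def)
  then show "int (card R) = q - s - 1" using sq by simp
  have "{y. (x, y) \<in> R} = (if s < x \<and> x < q then {h x} else {})"
    unfolding R by auto
  then show "card {y. (x, y) \<in> R} = (if s < x \<and> x < q then 1 else 0)"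
    by simp
qed

lemma col_add_ribbon:
  assumes T: "dyck_tiling n T" and sq: "- int n \<le> s" "q \<le> int n" "s < q"
  shows "col (add_ribbon s q T) x = col T x + (if s < x \<and> x < q then 1 else 0)"
proof -
  note R = add_ribbon_boxes[OF T sq]
  let ?R = "{(x, y). (x, y) \<in> upper T \<and> s < x \<and> x < q}"
  have "col (add_ribbon s q T) x = card ({y. (x, y) \<in> \<Union> (tiles T)} \<union> {y. (x, y) \<in> ?R})"
    unfolding col_def R(1) by (rule arg_cong[of _ _ card]) blast
  also have "\<dots> = col T x + card {y. (x, y) \<in> ?R}"
    unfolding col_def
  proof (rule card_Un_disjoint)
    show "finite {y. (x, y) \<in> \<Union> (tiles T)}"
      using finite_column[OF finite_Union_tiles[OF T]] .
    show "finite {y. (x, y) \<in> ?R}" using finite_column[OF R(4)] .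
    show "{y. (x, y) \<in> \<Union> (tiles T)} \<inter> {y. (x, y) \<in> ?R} = {}" using R(3) by blast
  qed
  finally show ?thesis unfolding R(6) by simp
qed

text \<open>Every ribbon box is a tile of its own, so it adds one to the area and one to the number
  of tiles, that is, one to \<open>art\<close>.\<close>

lemma art_add_ribbon:
  assumes T: "dyck_tiling n T" and sq: "- int n \<le> s" "q \<le> int n" "s < q"
    and T': "dyck_tiling n (add_ribbon s q T)"
  shows "art (add_ribbon s q T) = art T + real_of_int (q - s - 1)"
proof -
  note R = add_ribbon_boxes[OF T sq]
  let ?R = "{(x, y). (x, y) \<in> upper T \<and> s < x \<and> x < q}"
  have "area (add_ribbon s q T) = area T + card ?R"
    unfolding area_eq[OF T] area_eq[OF T'] R(1)
    using card_Un_disjoint[OF finite_Union_tiles[OF T] R(4,3)] .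
  moreover have "card (tiles (add_ribbon s q T)) = card (tiles T) + card ?R"
  proof -
    have "tiles T \<inter> (\<lambda>p. {p}) ` ?R = {}" using R(3) by blast
    then have "card (tiles T \<union> (\<lambda>p. {p}) ` ?R) = card (tiles T) + card ((\<lambda>p. {p}) ` ?R)"
      using finite_tiles[OF T] R(4) by (intro card_Un_disjoint) auto
    then show ?thesis unfolding R(2) by (simp add: card_image)
  qed
  ultimately have "art (add_ribbon s q T) = art T + real (card ?R)"
    by (simp add: art_def field_simps)
  also have "real (card ?R) = real_of_int (q - s - 1)" using R(5) by linarith
  finally show ?thesis .
qed

section \<open>The special column\<close>

text \<open>Spreading creates a peak at \<open>s\<close>. A spread tile that meets column
  \<open>s\<close> also meets column \<open>s - 1\<close>, so it cannot be the one-box tile that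
  would forbid eligibility.\<close>

lemma eligible_spread_self:
  assumes T: "dyck_tiling n T" and s: "\<bar>s\<bar> \<le> int n"
  shows "eligible (spread s T) s"
proof -
  obtain y where y: "(s, y) \<in> upper T"
    using dyck_path_total[OF dyck_tilingD(2)[OF T] s] .
  have "{(s, y + 1 - 2)} \<noteq> spread_points s t" for t
  proof
    assume eq: "{(s, y + 1 - 2)} = spread_points s t"
    then have "(s, y + 1 - 2) \<in> spread_points s t" by auto
    then have "(s - 1, y + 1 - 2 - 1) \<in> spread_points s t" by (simp add: mem_spread_points)
    then show False unfolding eq[symmetric] by simp
  qed
  then show ?thesis
    using y unfolding eligible_def
    by (intro exI[of _ "y + 1"]) (auto simp: spread_def mem_spread_points)
qed

lemma eligible_spread_right:
  assumes T: "dyck_tiling n T" and x: "s < x"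
  shows "eligible (spread s T) x \<longleftrightarrow> s + 1 < x \<and> eligible T (x - 1)"
proof (cases "x = s + 1")
  case True
  \<comment> \<open>An up step ending at \<open>s + 1\<close> after the spread would give the old
    upper path two heights in column \<open>s\<close>.\<close>
  then show ?thesis
    using dyck_path_fun[OF dyck_tilingD(2)[OF T], of s]
    unfolding eligible_def by (fastforce simp: spread_def mem_spread_points)
next
  case False
  with x have x: "s + 1 < x" by simp
  \<comment> \<open>Beyond \<open>s + 1\<close> the spread is a translation, so one-box tiles there
    come exactly from one-box tiles.\<close>
  have "{(x, z)} \<in> spread_points s ` tiles T \<longleftrightarrow> {(x - 1, z)} \<in> tiles T" for z
  proof -
    have "{(x, z)} = spread_points s {(x - 1, z)}"
      using x by (auto simp: mem_spread_points split: if_splits)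
    then show ?thesis by (simp add: inj_image_mem_iff[OF inj_spread_points])
  qed
  then show ?thesis
    using x unfolding eligible_def by (simp add: spread_def mem_spread_points)
qed

lemma finite_eligible:
  assumes "dyck_tiling n T"
  shows "finite {x. eligible T x}"
proof (rule finite_subset)
  show "{x. eligible T x} \<subseteq> {- int n..int n}"
    using dyck_tilingD(2)[OF assms] unfolding dyck_path_def eligible_def
    by (auto dest: dyck_shaped_bounds)
qed simp

lemma special_column_eqI:
  assumes "dyck_tiling n T" "eligible T c" "\<And>x. eligible T x \<Longrightarrow> x \<le> c"
  shows "special_column T = c"
  unfolding special_column_def using assms finite_eligible by (intro Max_eqI) auto

lemma eligible_add_ribbon_self:
  assumes "eligible T s"
  shows "eligible (add_ribbon s q T) s"
  using assms unfolding eligible_def add_ribbon_def by (force simp: image_iff)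

text \<open>Up steps under \<open>s < x < q\<close> end at top corners of ribbon boxes; right of
  \<open>q\<close> nothing changes and \<open>q\<close> was the rightmost eligible column. At
  \<open>q\<close> itself, raising column \<open>q - 1\<close> by two turns the up step into a down
  step.\<close>

lemma eligible_add_ribbon_le:
  assumes T: "dyck_tiling n T" and up: "(q - 1, y - 1) \<in> upper T" "(q, y) \<in> upper T" "s < q - 1"
    and max: "\<And>x. eligible T x \<Longrightarrow> x \<le> q" and x: "eligible (add_ribbon s q T) x"
  shows "x \<le> s"
proof (rule ccontr)
  assume "\<not> x \<le> s"
  have mem: "(a, b) \<in> upper (add_ribbon s q T) \<longleftrightarrow>
      (a, if s < a \<and> a < q then b - 2 else b) \<in> upper T" for a b
    unfolding add_ribbon_def by (force simp: image_iff)
  obtain z where z: "(x - 1, z - 1) \<in> upper (add_ribbon s q T)" "(x, z) \<in> upper (add_ribbon s q T)"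
    and t: "{(x, z - 2)} \<notin> tiles (add_ribbon s q T)"
    using x unfolding eligible_def by blast
  consider "x < q" | "x = q" | "q < x" by linarith
  then show False
  proof cases
    case 1
    then have "(x, z - 2) \<in> upper T" using z(2) \<open>\<not> x \<le> s\<close> unfolding mem by simp
    then show False using t 1 \<open>\<not> x \<le> s\<close> unfolding add_ribbon_def by auto
  next
    case 2
    then have "(q - 1, z - 1 - 2) \<in> upper T" "(q, z) \<in> upper T" using z up(3) unfolding mem by auto
    then have "z - 1 - 2 = y - 1" "z = y"
      using dyck_path_fun[OF dyck_tilingD(2)[OF T]] up(1,2) by blast+
    then show False by simp
  next
    case 3
    then have "(x - 1, z - 1) \<in> upper T" "(x, z) \<in> upper T" using z unfolding mem by auto
    moreover have "{(x, z - 2)} \<notin> tiles T" using t unfolding add_ribbon_def by simp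
    ultimately have "eligible T x" unfolding eligible_def by blast
    then show False using max[of x] 3 by simp
  qed
qed

text \<open>One insertion resets the rightmost eligible column to \<open>s\<close>. Eligibility of
  the old bound \<open>c\<close> is demanded only if \<open>s < c\<close>, so that
  \<open>c = 0\<close> can serve for the empty tiling.\<close>

lemma ribbon_grow_step:
  assumes T: "dyck_tiling n T" and s: "\<bar>s\<bar> \<le> int n"
    and max: "\<And>x. eligible T x \<Longrightarrow> x \<le> c" and c: "s < c \<Longrightarrow> eligible T c"
  shows "eligible (ribbon_grow T s) s"
    and "eligible (ribbon_grow T s) x \<Longrightarrow> x \<le> s"
    and "art (ribbon_grow T s) = art T + real (col T s) + (if s < c then real_of_int (c - s) else 0)"
    and "col (ribbon_grow T s) x =
      col T (if x < s then x + 1 else if x = s then s else x - 1) + (if s < x \<and> x \<le> c then 1 else 0)"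
proof -
  let ?T = "spread s T"
  have T': "dyck_tiling (Suc n) ?T" using dyck_tiling_spread[OF T s] .
  note right = eligible_spread_right[OF T]
  note self = eligible_spread_self[OF T s]
  have "eligible (ribbon_grow T s) s \<and> (eligible (ribbon_grow T s) x \<longrightarrow> x \<le> s) \<and>
    art (ribbon_grow T s) = art T + real (col T s) + (if s < c then real_of_int (c - s) else 0) \<and>
    col (ribbon_grow T s) x =
      col T (if x < s then x + 1 else if x = s then s else x - 1) + (if s < x \<and> x \<le> c then 1 else 0)"
  proof (cases "s < c")
    case False
    have le: "x \<le> s" if "eligible ?T x" for x
      using right[of s x] max[of "x - 1"] that False by fastforce
    have "special_column ?T = s" using special_column_eqI[OF T' self le] .
    then have "ribbon_grow T s = ?T" by (simp add: ribbon_grow_def Let_def)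
    then show ?thesis using self le False by (simp add: art_spread[OF T s] col_spread)
  next
    case True
    \<comment> \<open>The spread moves column \<open>c\<close> one to the right; the ribbon then
      fills the columns \<open>s + 1\<close> to \<open>c\<close>, which makes \<open>c - s\<close>
      boxes.\<close>
    let ?q = "c + 1"
    have q: "eligible ?T ?q" using right[of s ?q] c True by simp
    have le: "x \<le> ?q" if "eligible ?T x" for x
      using right[of s x] max[of "x - 1"] that True by fastforce
    have "special_column ?T = ?q" using special_column_eqI[OF T' q le] .
    then have eq: "ribbon_grow T s = add_ribbon s ?q ?T" using True by (simp add: ribbon_grow_def Let_def)
    obtain y where y: "(?q - 1, y - 1) \<in> upper ?T" "(?q, y) \<in> upper ?T"
      using q unfolding eligible_def by blast
    have bnd: "- int (Suc n) \<le> s" "?q \<le> int (Suc n)" "s < ?q"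
      using s True dyck_shaped_bounds[OF dyck_tilingD(2)[OF T', unfolded dyck_path_def] y(2)] by auto
    have "dyck_tiling (Suc n) (add_ribbon s ?q ?T)"
      using dyck_tiling_ribbon_grow[OF T s] unfolding eq .
    from art_add_ribbon[OF T' bnd this] col_add_ribbon[OF T' bnd]
      eligible_add_ribbon_self[OF self] eligible_add_ribbon_le[OF T' y _ le]
    show ?thesis using True unfolding eq by (simp add: art_spread[OF T s] col_spread)
  qed
  then show "eligible (ribbon_grow T s) s"
    and "eligible (ribbon_grow T s) x \<Longrightarrow> x \<le> s"
    and "art (ribbon_grow T s) = art T + real (col T s) + (if s < c then real_of_int (c - s) else 0)"
    and "col (ribbon_grow T s) x =
      col T (if x < s then x + 1 else if x = s then s else x - 1) + (if s < x \<and> x \<le> c then 1 else 0)"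
    by blast+
qed

section \<open>Growing along a permutation\<close>

text \<open>
  \<open>gap sg m v\<close> is the column of the valley of the zig-zag path of order \<open>m\<close> into which a new chord is
  inserted if its left endpoint compares with the first \<open>m\<close> ones as \<open>v\<close> does with \<open>sg 1, \<dots>, sg m\<close>.
\<close>

definition gap :: "(nat \<Rightarrow> nat) \<Rightarrow> nat \<Rightarrow> nat \<Rightarrow> int" where
  "gap sg m v = 2 * int (card {j. 1 \<le> j \<and> j \<le> m \<and> sg j < v}) - int m"

primrec grown :: "(nat \<Rightarrow> nat) \<Rightarrow> nat \<Rightarrow> tiling" where
  "grown sg 0 = empty_tiling"
| "grown sg (Suc m) = ribbon_grow (grown sg m) (gap sg m (sg (Suc m)))"

lemma gap_bound: "\<bar>gap sg m v\<bar> \<le> int m"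
proof -
  have "card {j. 1 \<le> j \<and> j \<le> m \<and> sg j < v} \<le> card {1..m}" by (rule card_mono) auto
  then show ?thesis by (simp add: gap_def)
qed

lemma gap_mono: "v \<le> w \<Longrightarrow> gap sg m v \<le> gap sg m w"
  unfolding gap_def by (auto intro!: card_mono)

text \<open>Inserting a chord pushes the valleys on its right one step right and those on its left
  one step left, as a spread does. For \<open>v = sg (Suc m)\<close> this names the valley just left
  of the new chord.\<close>

lemma gap_Suc: "gap sg (Suc m) v = gap sg m v + (if sg (Suc m) < v then 1 else -1)"
proof -
  let ?A = "{j. 1 \<le> j \<and> j \<le> m \<and> sg j < v}"
  have "{j. 1 \<le> j \<and> j \<le> Suc m \<and> sg j < v} = (if sg (Suc m) < v then insert (Suc m) ?A else ?A)"
    by (auto simp: le_Suc_eq)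
  then show ?thesis by (simp add: gap_def)
qed

lemma dyck_tiling_empty: "dyck_tiling 0 empty_tiling"
proof -
  have "dyck_path 0 {(0, 0)}"
    unfolding dyck_path_def dyck_shaped_def by (auto intro!: exI[of _ "\<lambda>_. 0"])
  then show ?thesis by (auto simp: dyck_tiling_def empty_tiling_def skew_boxes_def)
qed

lemma dyck_tiling_grown: "dyck_tiling m (grown sg m)"
  by (induction m) (simp_all add: dyck_tiling_empty dyck_tiling_ribbon_grow gap_bound)

text \<open>
  The empty tiling has no eligible column; the value \<open>0\<close> ensures that the first insertion, at column
  \<open>0\<close>, adds no ribbon.
\<close>

definition last_col :: "(nat \<Rightarrow> nat) \<Rightarrow> nat \<Rightarrow> int" where
  "last_col sg m = (case m of 0 \<Rightarrow> 0 | Suc k \<Rightarrow> gap sg k (sg m))"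

lemma eligible_grown:
  shows "eligible (grown sg m) x \<Longrightarrow> x \<le> last_col sg m"
    and "0 < m \<Longrightarrow> eligible (grown sg m) (last_col sg m)"
proof (induction m arbitrary: x)
  case 0
  { case 1 then show ?case by (auto simp: eligible_def empty_tiling_def) }
  { case 2 then show ?case by simp }
next
  case (Suc m)
  \<comment> \<open>For \<open>m = 0\<close> both columns are \<open>0\<close> and the premise
    fails; otherwise the induction hypothesis applies.\<close>
  have c: "eligible (grown sg m) (last_col sg m)" if "gap sg m (sg (Suc m)) < last_col sg m"
    using Suc.IH(2) that by (cases m) (auto simp: last_col_def gap_def)
  note st = ribbon_grow_step[OF dyck_tiling_grown gap_bound Suc.IH(1) c]
  { case 1 then show ?case using st(2) by (simp add: last_col_def) }
  { case 2 then show ?case using st(1) by (simp add: last_col_def) }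
qed

lemma grown_step:
  fixes sg m
  defines "s \<equiv> gap sg m (sg (Suc m))" and "c \<equiv> last_col sg m"
  shows "art (grown sg (Suc m)) =
      art (grown sg m) + real (col (grown sg m) s) + (if s < c then real_of_int (c - s) else 0)"
    and "col (grown sg (Suc m)) x =
      col (grown sg m) (if x < s then x + 1 else if x = s then s else x - 1) +
      (if s < x \<and> x \<le> c then 1 else 0)"
proof -
  have c: "eligible (grown sg m) c" if "s < c"
    using eligible_grown(2)[of m sg] that unfolding c_def s_def
    by (cases m) (auto simp: last_col_def gap_def)
  have "\<bar>s\<bar> \<le> int m" unfolding s_def by (rule gap_bound)
  note st = ribbon_grow_step[OF dyck_tiling_grown this eligible_grown(1)[of sg m, folded c_def] c]
  show "art (grown sg (Suc m)) =
      art (grown sg m) + real (col (grown sg m) s) + (if s < c then real_of_int (c - s) else 0)"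
    using st(3) by (simp add: s_def)
  show "col (grown sg (Suc m)) x =
      col (grown sg m) (if x < s then x + 1 else if x = s then s else x - 1) +
      (if s < x \<and> x \<le> c then 1 else 0)"
    using st(4) by (simp add: s_def)
qed

text \<open>The valley of a value \<open>v\<close> not yet inserted is followed through all
  insertions: its column is inherited each time and gains a box exactly when a ribbon passes over
  it, which happens at the descents enclosing \<open>v\<close>.\<close>

lemma col_grown:
  assumes "\<And>j. 1 \<le> j \<Longrightarrow> j \<le> m \<Longrightarrow> sg j \<noteq> v"
  shows "col (grown sg m) (gap sg m v) =
    card {k. 1 \<le> k \<and> k < m \<and> sg (Suc k) < v \<and> v < sg k}"
  using assms
proof (induction m)
  case 0
  then show ?case by (simp add: col_def empty_tiling_def)
next
  case (Suc m)
  let ?s = "gap sg m (sg (Suc m))" and ?c = "last_col sg m"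
  have ne: "sg (Suc m) \<noteq> v" using Suc.prems by simp
  have IH: "col (grown sg m) (gap sg m v) =
      card {k. 1 \<le> k \<and> k < m \<and> sg (Suc k) < v \<and> v < sg k}" (is "_ = card ?A")
    using Suc by simp
  \<comment> \<open>The index shift of the spread undoes \<open>gap_Suc\<close>. If \<open>v\<close>
    shares the valley of the inserted chord, its column is one of the two copies beside
    \<open>s\<close>.\<close>
  have 1: "(if gap sg (Suc m) v < ?s then gap sg (Suc m) v + 1
      else if gap sg (Suc m) v = ?s then ?s else gap sg (Suc m) v - 1) = gap sg m v"
    using gap_mono[of "sg (Suc m)" v sg m] gap_mono[of v "sg (Suc m)" sg m] ne
    by (auto simp: gap_Suc)
  \<comment> \<open>Being right of \<open>?s\<close> means \<open>sg (Suc m) < v\<close>. Then two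
    shifts separate the valley from its place at step \<open>l\<close>: they cancel if
    \<open>v < sg m\<close>, leaving it at or left of \<open>?c\<close>, and add up to two
    otherwise, moving it past \<open>?c\<close>.\<close>
  have 2: "?s < gap sg (Suc m) v \<and> gap sg (Suc m) v \<le> ?c \<longleftrightarrow>
      1 \<le> m \<and> sg (Suc m) < v \<and> v < sg m"
  proof (cases m)
    case 0
    then show ?thesis by (simp add: gap_def last_col_def)
  next
    case (Suc l)
    then have "sg m \<noteq> v" using Suc.prems by simp
    then show ?thesis
      using gap_mono[of "sg (Suc m)" v sg m] gap_mono[of v "sg (Suc m)" sg m] ne
        gap_mono[of "sg m" v sg l] gap_mono[of v "sg m" sg l] Suc
      by (auto simp: gap_Suc last_col_def)
  qed
  have "{k. 1 \<le> k \<and> k < Suc m \<and> sg (Suc k) < v \<and> v < sg k} =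
      (if 1 \<le> m \<and> sg (Suc m) < v \<and> v < sg m then insert m ?A else ?A)"
    by (auto simp: less_Suc_eq)
  then show ?case unfolding grown_step(2) 1 2 IH by simp
qed


section \<open>Ribbon lengths at descents and the resulting formula for \<open>art\<close>\<close>

definition between :: "(nat \<Rightarrow> nat) \<Rightarrow> nat \<Rightarrow> nat set \<Rightarrow> nat set" where
  "between sg k A = {j \<in> A. sg (Suc k) < sg j \<and> sg j < sg k}"

text \<open>The ribbon length at a descent. Each earlier enclosed value is a chord of width two
  between the two valleys.\<close>

lemma gap_diff:
  assumes "inj sg" "sg (Suc (Suc l)) < sg (Suc l)"
  shows "gap sg l (sg (Suc l)) - gap sg (Suc l) (sg (Suc (Suc l))) =
    1 + 2 * int (card (between sg (Suc l) {1..<Suc l}))"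
proof -
  let ?m = "Suc l"
  let ?A = "{j. 1 \<le> j \<and> j \<le> ?m \<and> sg j < sg (Suc ?m)}"
  have "{j. 1 \<le> j \<and> j \<le> ?m \<and> sg j < sg ?m} = ?A \<union> between sg ?m {1..<?m}"
  proof (rule set_eqI)
    fix j
    have "sg j \<noteq> sg (Suc ?m)" if "j \<le> ?m" using injD[OF assms(1), of j "Suc ?m"] that by auto
    then show "j \<in> {j. 1 \<le> j \<and> j \<le> ?m \<and> sg j < sg ?m} \<longleftrightarrow> j \<in> ?A \<union> between sg ?m {1..<?m}"
      using assms(2) by (cases "j = ?m") (auto simp: between_def)
  qed
  also have "card \<dots> = card ?A + card (between sg ?m {1..<?m})"
    by (rule card_Un_disjoint) (auto simp: between_def)
  finally have "gap sg ?m (sg ?m) = gap sg ?m (sg (Suc ?m)) + 2 * int (card (between sg ?m {1..<?m}))"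
    by (simp add: gap_def)
  \<comment> \<open>The summand \<open>1\<close> arises because the insertion at step
    \<open>?m\<close> moves the valley of its own value one to the left.\<close>
  then show ?thesis using gap_Suc[of sg l "sg ?m"] by simp
qed

text \<open>The first sum collects the spreads, indexed by the inserted position \<open>j\<close>;
  the second collects the ribbons, indexed by descents.\<close>

lemma art_grown:
  assumes "inj sg"
  shows "art (grown sg m) = real (
    (\<Sum>j\<in>{1..m}. card {k \<in> DES m sg. Suc k < j \<and> sg (Suc k) < sg j \<and> sg j < sg k}) +
    (\<Sum>k\<in>DES m sg. 1 + 2 * card (between sg k {1..<k})))"
proof (induction m)
  case 0
  show ?case by (simp add: art_def area_eq[OF dyck_tiling_empty] DES_def) (simp add: empty_tiling_def)
next
  case (Suc m)
  let ?s = "gap sg m (sg (Suc m))" and ?c = "last_col sg m"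
  let ?r = "\<lambda>k. card (between sg k {1..<k})"
  let ?C = "\<lambda>m j. card {k \<in> DES m sg. Suc k < j \<and> sg (Suc k) < sg j \<and> sg j < sg k}"
  have ne: "sg j \<noteq> sg (Suc m)" if "j \<le> m" for j
    using injD[OF assms, of j "Suc m"] that by auto
  have col: "col (grown sg m) ?s = ?C (Suc m) (Suc m)"
    by (subst col_grown[OF ne]) (auto simp: DES_def intro!: arg_cong[of _ _ card])
  \<comment> \<open>The only possible new descent is \<open>m\<close>, and \<open>Suc m < j\<close>
    excludes it, so earlier contributions do not change.\<close>
  have C: "?C m j = ?C (Suc m) j" if "j \<le> m" for j
    using that by (intro arg_cong[of _ _ card]) (auto simp: DES_def)
  have D: "DES (Suc m) sg = (if 1 \<le> m \<and> sg (Suc m) < sg m then insert m (DES m sg) else DES m sg)"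
    by (auto simp: DES_def less_Suc_eq)
  have fin: "finite (DES m sg)" by (rule finite_subset[of _ "{..<m}"]) (auto simp: DES_def)
  have "m \<notin> DES m sg" by (simp add: DES_def)
  \<comment> \<open>At an ascent the valley of \<open>sg (Suc m)\<close> is moved right of
    \<open>?c\<close> by the previous insertion; at a descent \<open>gap_diff\<close> is
    positive.\<close>
  have iff: "?s < ?c \<longleftrightarrow> 1 \<le> m \<and> sg (Suc m) < sg m"
  proof (cases m)
    case 0
    then show ?thesis by (simp add: gap_def last_col_def)
  next
    case (Suc l)
    then show ?thesis
      using gap_diff[OF assms, of l] gap_mono[of "sg m" "sg (Suc m)" sg l] gap_Suc[of sg l "sg (Suc m)"]
        ne[of m]
      by (auto simp: last_col_def)
  qed
  have diff: "?c - ?s = 1 + 2 * int (?r m)" if "1 \<le> m" "sg (Suc m) < sg m"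
    using gap_diff[OF assms, of "m - 1"] that by (cases m) (auto simp: last_col_def)
  have "(if ?s < ?c then real_of_int (?c - ?s) else 0) + real (\<Sum>k\<in>DES m sg. 1 + 2 * ?r k) =
      real (\<Sum>k\<in>DES (Suc m) sg. 1 + 2 * ?r k)"
    unfolding iff D using diff fin \<open>m \<notin> DES m sg\<close> by simp
  moreover have "(\<Sum>j\<in>{1..m}. ?C m j) + ?C (Suc m) (Suc m) = (\<Sum>j\<in>{1..Suc m}. ?C (Suc m) j)"
    using C by simp
  ultimately show ?case
    unfolding grown_step(1) Suc.IH col by linarith
qed

section \<open>Double counting of enclosed values\<close>

lemma art_grown_eq_mad:
  assumes p: "sg permutes {1..n}"
  shows "art (grown sg n) = real (mad n sg)"
proof -
  have inj: "inj sg" using permutes_inj[OF p] .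
  have fin: "finite (DES n sg)" by (rule finite_subset[of _ "{..<n}"]) (auto simp: DES_def)
  have swap: "(\<Sum>j\<in>{1..n}. card {k \<in> DES n sg. Suc k < j \<and> sg (Suc k) < sg j \<and> sg j < sg k}) =
      (\<Sum>k\<in>DES n sg. card (between sg k {Suc (Suc k)..n}))"
  proof -
    have "(\<Sum>k\<in>DES n sg. card (between sg k {Suc (Suc k)..n})) =
        (\<Sum>k\<in>DES n sg. card {j \<in> {1..n}. Suc k < j \<and> sg (Suc k) < sg j \<and> sg j < sg k})"
      by (intro sum.cong refl arg_cong[of _ _ card]) (auto simp: between_def)
    also have "\<dots> = (\<Sum>j\<in>{1..n}. card {k \<in> DES n sg. Suc k < j \<and> sg (Suc k) < sg j \<and> sg j < sg k})"
      using fin by (intro sum_multicount_gen) auto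
    finally show ?thesis by simp
  qed
  \<comment> \<open>Since \<open>sg\<close> permutes \<open>{1..n}\<close>, every value strictly
    between the two letters of the descent occurs at a position before \<open>k\<close> or after
    \<open>Suc k\<close>.\<close>
  have diff: "sg k - sg (k + 1) = 1 + card (between sg k {1..<k}) + card (between sg k {Suc (Suc k)..n})"
    if "k \<in> DES n sg" for k
  proof -
    have k: "1 \<le> k" "k < n" "sg (Suc k) < sg k" using that by (auto simp: DES_def)
    have "sg k \<le> n" using permutes_in_image[OF p, of k] k by simp
    have "{sg (Suc k)<..<sg k} = sg ` between sg k {1..n}"
    proof (intro set_eqI iffI)
      fix v assume v: "v \<in> {sg (Suc k)<..<sg k}"
      then have "v \<in> {1..n}" using \<open>sg k \<le> n\<close> by auto
      then obtain j where "j \<in> {1..n}" "v = sg j" using permutes_image[OF p] by blast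
      then show "v \<in> sg ` between sg k {1..n}" using v by (auto simp: between_def)
    qed (auto simp: between_def)
    also have "card \<dots> = card (between sg k {1..n})"
      by (rule card_image) (rule inj_on_subset[OF inj], simp)
    also have "between sg k {1..n} = between sg k {1..<k} \<union> between sg k {Suc (Suc k)..n}"
    proof (rule set_eqI)
      fix j
      have "j < k \<or> j = k \<or> j = Suc k \<or> Suc (Suc k) \<le> j" by linarith
      then show "j \<in> between sg k {1..n} \<longleftrightarrow>
          j \<in> between sg k {1..<k} \<union> between sg k {Suc (Suc k)..n}"
        using k by (auto simp: between_def)
    qed
    also have "card \<dots> = card (between sg k {1..<k}) + card (between sg k {Suc (Suc k)..n})"
      by (rule card_Un_disjoint) (auto simp: between_def)
    finally show ?thesis using k by simp
  qed
  have "desdif n sg = (\<Sum>k\<in>DES n sg. 1 + card (between sg k {1..<k}) + card (between sg k {Suc (Suc k)..n}))"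
    unfolding desdif_def using diff by simp
  moreover have "res n sg = (\<Sum>k\<in>DES n sg. card (between sg k {1..<k}))"
    unfolding res_def by (intro sum.cong refl arg_cong[of _ _ card]) (auto simp: between_def)
  ultimately have "mad n sg = (\<Sum>k\<in>DES n sg. card (between sg k {Suc (Suc k)..n})) +
      (\<Sum>k\<in>DES n sg. 1 + 2 * card (between sg k {1..<k}))"
    unfolding mad_def by (simp only: sum.distrib[symmetric]) (rule sum.cong; simp)
  then show ?thesis unfolding art_grown[OF inj] swap by simp
qed

section \<open>Insertion sequences for the zig-zag path\<close>

lemma zigzag_eq: "zigzag n = (\<lambda>x. (x, (x + int n) mod 2)) ` {- int n..int n}"
proof -
  let ?w = "concat (replicate n [U, D])"
  have len: "length ?w = 2 * n" by (induction n) auto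
  have sum: "sum_list (map rise (take k (concat (replicate n [U, D])))) = int k mod 2"
    if "k \<le> 2 * n" for k n
    using that
  proof (induction n arbitrary: k)
    case (Suc n)
    consider "k = 0" | "k = 1" | l where "k = Suc (Suc l)" by (metis One_nat_def nat.exhaust)
    then show ?case
    proof cases
      case 3
      \<comment> \<open>Removing the leading U and D leaves both the height and the parity of
        \<open>k\<close> unchanged.\<close>
      then show ?thesis using Suc by simp
    qed simp_all
  qed simp
  have "zigzag n = (\<lambda>k. (int k - int n, int k mod 2)) ` {0..2 * n}"
    unfolding zigzag_def path_of_def len using sum by (intro image_cong) auto
  also have "\<dots> = (\<lambda>x. (x, (x + int n) mod 2)) ` (\<lambda>k. int k - int n) ` {0..2 * n}"
    by (simp add: image_image)
  also have "(\<lambda>k. int k - int n) ` {0..2 * n} = {- int n..int n}"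
  proof (intro set_eqI iffI)
    fix x assume "x \<in> {- int n..int n}"
    then show "x \<in> (\<lambda>k. int k - int n) ` {0..2 * n}"
      by (intro image_eqI[of _ _ "nat (x + int n)"]) auto
  qed auto
  finally show ?thesis .
qed

lemma chords_zigzag: "chords (zigzag n) = (\<lambda>i. (2 * int i - int n, 2 * int i - int n + 1)) ` {..<n}"
proof -
  have mem: "(x, y) \<in> zigzag n \<longleftrightarrow> - int n \<le> x \<and> x \<le> int n \<and> y = (x + int n) mod 2" for x y
    unfolding zigzag_eq mem_graph by simp
  have "(l, r) \<in> chords (zigzag n) \<longleftrightarrow>
      (l, r) \<in> (\<lambda>i. (2 * int i - int n, 2 * int i - int n + 1)) ` {..<n}" for l r
  proof
    assume "(l, r) \<in> chords (zigzag n)"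
    then obtain y where y: "l < r" "(l, y) \<in> zigzag n" "(l + 1, y + 1) \<in> zigzag n"
      "(r, y + 1) \<in> zigzag n" "(r + 1, y) \<in> zigzag n"
      and above: "\<And>x z. l < x \<Longrightarrow> x \<le> r \<Longrightarrow> (x, z) \<in> zigzag n \<Longrightarrow> y < z"
      unfolding chords_def by blast
    have y0: "y = 0" "even (l + int n)" using y(2,3) unfolding mem by presburger+
    \<comment> \<open>The path is back at height \<open>0\<close> in column \<open>l + 2\<close>,
      where a longer chord would have to lie strictly above \<open>0\<close>.\<close>
    have "r = l + 1"
    proof (rule ccontr)
      assume "r \<noteq> l + 1"
      then have "l + 2 \<le> r" using y(1) by simp
      then have "(l + 2, 0) \<in> zigzag n" using y(2,4) y0 unfolding mem by auto
      then show False using above[of "l + 2" 0] \<open>l + 2 \<le> r\<close> y0 by simp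
    qed
    moreover obtain i where "l + int n = 2 * i" using y0(2) by (elim evenE)
    ultimately show "(l, r) \<in> (\<lambda>i. (2 * int i - int n, 2 * int i - int n + 1)) ` {..<n}"
      using y(2,5) unfolding mem by (intro image_eqI[of _ _ "nat i"]) auto
  next
    assume "(l, r) \<in> (\<lambda>i. (2 * int i - int n, 2 * int i - int n + 1)) ` {..<n}"
    then obtain i where i: "i < n" "l = 2 * int i - int n" "r = l + 1" by auto
    have "y < z" if "l < x" "x \<le> r" "(x, z) \<in> zigzag n" "y = 0" for x y z
    proof -
      have "x = l + 1" using that i by simp
      then show ?thesis using that(3,4) i unfolding mem by simp
    qed
    then show "(l, r) \<in> chords (zigzag n)"
      unfolding chords_def using i by (auto simp: mem intro!: exI[of _ 0])
  qed
  then show ?thesis by auto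
qed

text \<open>The chords are disjoint and follow one another, so an earlier chord starts left of a
  later left endpoint exactly when it ends left of it. Both counts in \<open>tree_seq\<close>
  therefore agree, which is the factor two in \<open>gap\<close>.\<close>

lemma tree_seq_zigzag:
  assumes p: "sg permutes {1..n}"
  shows "length (tree_seq (zigzag n) sg) = n"
    and "i < n \<Longrightarrow> int (tree_seq (zigzag n) sg ! i) - int i = gap sg i (sg (Suc i))"
proof -
  let ?f = "\<lambda>i. 2 * int i - int n"
  have card: "card (chords (zigzag n)) = n"
    unfolding chords_zigzag by (simp add: card_image inj_on_def)
  then show "length (tree_seq (zigzag n) sg) = n"
    unfolding tree_seq_def by simp
  \<comment> \<open>The explicit list is strictly increasing with the right set of entries, which
    determines it.\<close>
  have "sorted_list_of_set (fst ` chords (zigzag n)) = map ?f [0..<n]"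
    by (rule sorted_list_of_set_unique[THEN iffD1])
      (auto simp: chords_zigzag image_image strict_sorted_iff sorted_map distinct_map inj_on_def
        sorted_wrt_iff_nth_less lessThan_atLeast0 card_image)
  then have left: "left_end (zigzag n) sg j = ?f (sg j - 1)" if "j \<in> {1..n}" for j
    using permutes_in_image[OF p, of j] that unfolding left_end_def by auto
  have right: "right_end (zigzag n) sg j = ?f (sg j - 1) + 1" if "j \<in> {1..n}" for j
    unfolding right_end_def left[OF that]
  proof (rule the_equality)
    show "(?f (sg j - 1), ?f (sg j - 1) + 1) \<in> chords (zigzag n)"
      unfolding chords_zigzag using permutes_in_image[OF p, of j] that
      by (intro image_eqI[of _ _ "sg j - 1"]) auto
  qed (auto simp: chords_zigzag)
  show "int (tree_seq (zigzag n) sg ! i) - int i = gap sg i (sg (Suc i))" if i: "i < n"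
  proof -
    have pos: "1 \<le> sg j" if "j \<in> {1..n}" for j
      using permutes_in_image[OF p, of j] that by simp
    have eq: "left_end (zigzag n) sg j < left_end (zigzag n) sg (Suc i) \<longleftrightarrow> sg j < sg (Suc i)"
      "right_end (zigzag n) sg j < left_end (zigzag n) sg (Suc i) \<longleftrightarrow> sg j < sg (Suc i)"
      if "1 \<le> j" "j \<le> i" for j
      using that i left[of j] right[of j] left[of "Suc i"] pos[of j] pos[of "Suc i"] by auto
    have "{j. 1 \<le> j \<and> j < Suc i \<and> left_end (zigzag n) sg j < left_end (zigzag n) sg (Suc i)} =
        {j. 1 \<le> j \<and> j \<le> i \<and> sg j < sg (Suc i)}"
      "{j. 1 \<le> j \<and> j < Suc i \<and> right_end (zigzag n) sg j < left_end (zigzag n) sg (Suc i)} =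
        {j. 1 \<le> j \<and> j \<le> i \<and> sg j < sg (Suc i)}"
      using eq by (auto simp: less_Suc_eq_le)
    then show ?thesis
      using i card by (simp add: tree_seq_def gap_def del: upt_Suc)
  qed
qed

lemma DTR_zigzag:
  assumes p: "sg permutes {1..n}"
  shows "DTR (zigzag n) sg = grown sg n"
proof -
  let ?ps = "tree_seq (zigzag n) sg"
  have "fold (\<lambda>i T. ribbon_grow T (int (?ps ! i) - int i)) [0..<m] empty_tiling = grown sg m"
    if "m \<le> n" for m
    using that by (induction m) (simp_all add: tree_seq_zigzag(2)[OF p])
  then show ?thesis by (simp add: DTR_def DTR_seq_def tree_seq_zigzag(1)[OF p])
qed

theorem theorem10:
  fixes n :: nat and \<sigma> :: "nat \<Rightarrow> nat"
  assumes "\<sigma> permutes {1..n}"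
  shows "art (DTR (zigzag n) \<sigma>) = real (mad n \<sigma>)"
  using assms by (simp add: DTR_zigzag art_grown_eq_mad)

end
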